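(* Let $S$ and $T$ be $\mathbb{F}_q$-subspaces of $\mathbb{F}_{q^n}$ with $\dim_{\mathbb{F}_q}S+\dim_{\mathbb{F}_q}T=k\le n$, let $t=\dim_{\mathbb{F}_q}T$, $s=\dim_{\mathbb{F}_q}S$ with $t\ge s$, and let $U=T\times S\subseteq\mathbb{F}_{q^n}^2$. Then the following are equivalent: (i) $|L_U|=q^{k-1}+\dots+q^{t}-q^{s-1}-\dots-q+1$; (ii) all the points of $L_U$ different from $\langle(1,0)\rangle_{\mathbb{F}_{q^n}}$ and $\langle(0,1)\rangle_{\mathbb{F}_{q^n}}$ have weight one in $L_U$; (iii) $S\cdot S^{-1}\cap T\cdot T^{-1}=\mathbb{F}_q$; (iv) $\dim_{\mathbb{F}_q}(S\cap\alpha T)\le 1$ for every $\alpha\in\mathbb{F}_{q^n}^*$.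
   Context: For an $\mathbb{F}_q$-subspace $U$ of $\mathbb{F}_{q^n}^2$, $L_U=\{\langle \mathbf u\rangle_{\mathbb{F}_{q^n}}\colon \mathbf u\in U\setminus\{\mathbf 0\}\}\subseteq\mathrm{PG}(1,q^n)$, and the weight of a point $\langle\mathbf v\rangle_{\mathbb{F}_{q^n}}$ in $L_U$ is $\dim_{\mathbb{F}_q}(U\cap\langle\mathbf v\rangle_{\mathbb{F}_{q^n}})$. For subsets $A,B\subseteq\mathbb{F}_{q^n}$, $A\cdot B=\{ab\colon a\in A,b\in B\}$ and $A^{-1}=\{a^{-1}\colon a\in A\setminus\{0\}\}$.
   Formalization: The subspace S (hence also T) is assumed nonzero, i.e. s ≥ 1; for S = {0} and T = F_q, (ii) and (iv) hold while S·S^{-1} is empty, so (iii) fails. *)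

theory Defs
  imports "HOL-Analysis.Product_Vector" "HOL-Library.Set_Algebras" "HOL-Library.Cardinality"
begin

(* The extension F_{q^n}/F_q is given by two finite field types 'q (for F_q) and 'a (for F_{q^n})
   together with a ring homomorphism emb :: 'q => 'a; F_q, as a subset of F_{q^n}, is range emb. *)
locale field_embedding =
  fixes emb :: "'q::field \<Rightarrow> 'a::field"
  assumes emb_one: "emb 1 = 1"
    and emb_add: "emb (x + y) = emb x + emb y"
    and emb_mult: "emb (x * y) = emb x * emb y"

definition fq_scale :: "('q::field \<Rightarrow> 'a::field) \<Rightarrow> 'q \<Rightarrow> 'a \<Rightarrow> 'a" where
  "fq_scale emb c x = emb c * x"

abbreviation fq_subspace :: "('q::field \<Rightarrow> 'a::field) \<Rightarrow> 'a set \<Rightarrow> bool" where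
  "fq_subspace emb \<equiv> module.subspace (fq_scale emb)"

abbreviation fq_dim :: "('q::field \<Rightarrow> 'a::field) \<Rightarrow> 'a set \<Rightarrow> nat" where
  "fq_dim emb \<equiv> vector_space.dim (fq_scale emb)"

(* Dimension over F_q of a subset of F_{q^n}^2. *)
abbreviation fq_dim2 :: "('q::field \<Rightarrow> 'a::field) \<Rightarrow> ('a \<times> 'a) set \<Rightarrow> nat" where
  "fq_dim2 emb \<equiv> vector_space.dim (module_prod.scale (fq_scale emb) (fq_scale emb))"

(* The F_{q^n}-span of a vector of F_{q^n}^2; for v \<noteq> 0 this is a point of PG(1,q^n). *)
definition point :: "'a::field \<times> 'a \<Rightarrow> ('a \<times> 'a) set" where
  "point v = module.span (module_prod.scale (*) (*)) {v}"

definition linear_set :: "('a::field \<times> 'a) set \<Rightarrow> ('a \<times> 'a) set set" where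
  "linear_set U = {point u | u. u \<in> U - {0}}"

definition weight :: "('q::field \<Rightarrow> 'a::field) \<Rightarrow> ('a \<times> 'a) set \<Rightarrow> ('a \<times> 'a) set \<Rightarrow> nat" where
  "weight emb U P = fq_dim2 emb (U \<inter> P)"

(* The product A \<cdot> B of subsets of a field is A * B from HOL-Library.Set_Algebras. *)
definition inv_set :: "'a::field set \<Rightarrow> 'a set" where
  "inv_set A = {inverse a | a. a \<in> A - {0}}"

(* module.subspace, module.span, vector_space.dim and module_prod.scale are the intended notions
   only over actual vector spaces, which the scalings above are. *)

sublocale field_embedding \<subseteq> Fq: vector_space_prod "fq_scale emb" "fq_scale emb"
  by unfold_locales (simp_all add: fq_scale_def emb_one emb_add emb_mult algebra_simps)

lemma vector_space_prod_self:
  "vector_space_prod ((*) :: 'a::field \<Rightarrow> 'a \<Rightarrow> 'a) ((*) :: 'a \<Rightarrow> 'a \<Rightarrow> 'a)"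
  by unfold_locales (simp_all add: algebra_simps)

lemma point_eq: "point v = {(c * fst v, c * snd v) | c. True}"
proof -
  interpret V: vector_space_prod "(*) :: 'a \<Rightarrow> 'a \<Rightarrow> 'a" "(*) :: 'a \<Rightarrow> 'a \<Rightarrow> 'a"
    by (rule vector_space_prod_self)
  show ?thesis
    unfolding point_def V.p.span_singleton V.scale_def by auto
qed

end

theory Submission
  imports Defs
begin

(* The nonzero vectors of U are partitioned by the points of L_U, so
   |U| - 1 is the sum of q^w - 1 over the weights w of the points.  The points (1,0) and (0,1)
   contribute q^t - 1 and q^s - 1, and each other point contributes at least q - 1; hence (i) is
   the equality case of the resulting bound on |L_U|, which is (ii).  The weight of the point
   through (x,y), with x and y nonzero, is the dimension of S \<inter> (y/x) T, which gives (iv).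
   Finally an element of S S^{-1} \<inter> T T^{-1} outside F_q is the ratio of two independent
   elements of some S \<inter> \<alpha> T. *)

section \<open>Counting in vector spaces over a finite field\<close>

context vector_space
begin

text \<open>Adjoining a vector \<open>b\<close> outside \<open>span B\<close> multiplies the size by
  the number of scalars, since each element of the new span is \<open>scale c b + x\<close> for
  exactly one pair \<open>(c, x)\<close>.\<close>

lemma card_span_independent:
  assumes "finite (UNIV :: 'a set)" "finite B" "independent B"
  shows "finite (span B) \<and> card (span B) = CARD('a) ^ card B"
  using assms(2,3)
proof (induction B rule: finite_induct)
  case empty
  then show ?case by simp
next
  case (insert b B)
  have b: "b \<notin> span B" and B: "independent B"
    using insert by (simp_all add: independent_insert)
  let ?f = "\<lambda>(c, x). scale c b + x"
  have "span (insert b B) = ?f ` (UNIV \<times> span B)"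
  proof (intro equalityI subsetI)
    fix x assume "x \<in> span (insert b B)"
    then obtain k where "x - scale k b \<in> span B" by (auto simp: span_insert)
    then show "x \<in> ?f ` (UNIV \<times> span B)"
      by (intro image_eqI[of _ _ "(k, x - scale k b)"]) simp_all
  next
    fix x assume "x \<in> ?f ` (UNIV \<times> span B)"
    then obtain k y where "y \<in> span B" "x = scale k b + y" by auto
    then show "x \<in> span (insert b B)"
      by (auto simp: span_insert intro!: exI[of _ k])
  qed
  moreover have "inj_on ?f (UNIV \<times> span B)"
  proof (rule inj_onI, clarify)
    fix c x d y
    assume x: "x \<in> span B" and y: "y \<in> span B" and eq: "scale c b + x = scale d b + y"
    have "scale (c - d) b = y - x"
      using eq by (simp add: scale_left_diff_distrib algebra_simps)
    then have "scale (c - d) b \<in> span B"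
      using span_diff[OF y x] by simp
    \<comment> \<open>Otherwise scaling by \<open>inverse (c - d)\<close> would put \<open>b\<close>
      itself into \<open>span B\<close>.\<close>
    then have "c = d"
      using b span_scale[of "scale (c - d) b" B "inverse (c - d)"] by (cases "c = d") auto
    then show "c = d \<and> x = y" using eq by simp
  qed
  ultimately show ?case
    using insert B assms(1) by (simp add: card_image card_cartesian_product)
qed

lemma card_subspace_eq_power_dim:
  assumes "finite (UNIV :: 'a set)" "finite W" "subspace W"
  shows "card W = CARD('a) ^ dim W"
proof -
  obtain B where B: "B \<subseteq> W" "independent B" "W \<subseteq> span B" "card B = dim W"
    by (rule basis_exists)
  then have "span B = W"
    using assms(3) by (simp add: span_minimal subset_antisym)
  then show ?thesis
    using card_span_independent[OF assms(1) finite_subset[OF B(1) assms(2)] B(2)] B(4) by simp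
qed

text \<open>This turns a dimension bound into proportionality of pairs, the form in which (iv) is
  compared with (iii). Forwards it is a count: the line through a nonzero \<open>y\<close> already
  has as many elements as \<open>W\<close> can have.\<close>

lemma dim_le_1_iff:
  assumes fin: "finite (UNIV :: 'a set)" "finite W" and W: "subspace W"
  shows "dim W \<le> 1 \<longleftrightarrow> (\<forall>x\<in>W. \<forall>y\<in>W. y \<noteq> 0 \<longrightarrow> (\<exists>c. x = scale c y))"
proof
  assume dim: "dim W \<le> 1"
  have *: "card W \<le> CARD('a)"
    using power_increasing[OF dim, of "CARD('a)"] fin
    by (simp add: card_subspace_eq_power_dim[OF fin W] Suc_leI finite_UNIV_card_ge_0)
  show "\<forall>x\<in>W. \<forall>y\<in>W. y \<noteq> 0 \<longrightarrow> (\<exists>c. x = scale c y)"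
  proof (intro ballI impI)
    fix x y
    assume x: "x \<in> W" and y: "y \<in> W" "y \<noteq> 0"
    have "span {y} \<subseteq> W" using y W by (simp add: span_minimal)
    moreover have "card (span {y}) = CARD('a)"
      using card_span_independent[OF fin(1), of "{y}"] y by simp
    ultimately have "span {y} = W"
      using card_seteq[OF fin(2)] * by simp
    then show "\<exists>c. x = scale c y" using x by (auto simp: span_singleton)
  qed
next
  assume multiple: "\<forall>x\<in>W. \<forall>y\<in>W. y \<noteq> 0 \<longrightarrow> (\<exists>c. x = scale c y)"
  \<comment> \<open>For the zero space \<open>y = 0\<close> serves; either way \<open>W\<close> lies
    in the span of a one-element set.\<close>
  obtain y where "W \<subseteq> span {y}"
  proof (cases "W \<subseteq> {0}")
    case True
    then show ?thesis using that[of 0] by simp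
  next
    case False
    then obtain y where "y \<in> W" "y \<noteq> 0" by auto
    then have "W \<subseteq> span {y}" using multiple unfolding span_singleton by blast
    then show ?thesis by (rule that)
  qed
  then show "dim W \<le> 1"
    using dim_le_card[of W "{y}"] by simp
qed

end

section \<open>Points of the projective line and the partition of U\<close>

lemma one_less_card_field: "1 < CARD('a::{field,finite})"
proof -
  have "card {0, 1::'a} \<le> CARD('a)" by (intro card_mono) auto
  then show ?thesis by simp
qed

lemma point_eq_of_mem:
  assumes "v \<noteq> 0" "v \<in> point u"
  shows "point v = point u"
proof -
  obtain c where v: "v = (c * fst u, c * snd u)"
    using assms(2) by (auto simp: point_eq)
  have c: "c \<noteq> 0" using assms(1) v by (auto simp: zero_prod_def)
  have "d * fst u = (d / c) * fst v \<and> d * snd u = (d / c) * snd v" for d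
    using c by (simp add: v)
  moreover have "d * fst v = (d * c) * fst u \<and> d * snd v = (d * c) * snd u" for d
    by (simp add: v mult.assoc)
  ultimately show ?thesis
    unfolding point_eq by (auto; metis)
qed

lemma in_point: "v \<in> point v"
  unfolding point_eq by (auto intro: exI[of _ 1] simp: prod_eq_iff)

text \<open>The nonzero vectors of \<open>U\<close> are grouped by the point they span; the fibre
  over \<open>P\<close> is \<open>U \<inter> P\<close> without the zero vector. Integers keep the
  subtractions exact.\<close>

lemma card_linear_set_partition:
  fixes U :: "('a::{field,finite} \<times> 'a) set"
  assumes "0 \<in> U"
  shows "int (card U) - 1 = (\<Sum>P\<in>linear_set U. int (card (U \<inter> P)) - 1)"
proof -
  have L: "linear_set U = point ` (U - {0})"
    by (auto simp: linear_set_def)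
  have z: "0 \<in> point v" for v :: "'a \<times> 'a"
    by (auto simp: point_eq zero_prod_def)
  have fib: "{v \<in> U - {0}. point v = P} = U \<inter> P - {0}" if P: "P \<in> linear_set U" for P
  proof -
    obtain u where "P = point u" using P by (auto simp: L)
    then have "point v = P \<longleftrightarrow> v \<in> P" if "v \<noteq> 0" for v
      using in_point[of v] point_eq_of_mem[OF that, of u] by auto
    then show ?thesis by auto
  qed
  have "card (U - {0}) = (\<Sum>P\<in>linear_set U. card {v \<in> U - {0}. point v = P})"
    using sum.image_gen[of "U - {0}" "\<lambda>_. 1::nat" point] by (simp add: L)
  also have "\<dots> = (\<Sum>P\<in>linear_set U. card (U \<inter> P - {0}))"
    using fib by (intro sum.cong refl) (rule arg_cong[of _ _ card])
  finally have "int (card (U - {0})) = (\<Sum>P\<in>linear_set U. int (card (U \<inter> P - {0})))"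
    by simp
  moreover have "int (card (A - {0})) = int (card A) - 1" if "0 \<in> A" for A :: "('a \<times> 'a) set"
  proof -
    have "card A > 0" using that by (auto simp: card_gt_0_iff)
    then show ?thesis using that by simp
  qed
  ultimately show ?thesis
    using assms z by (auto simp: L intro!: sum.cong)
qed

text \<open>With G = 1 + x + ... + x^(s-1), the first sum is x^t G and the second is G - 1, so the
  bracket is (x^t - 1) G. The right-hand side is (x^t - 1)(x^s - 1), which for x = q counts the
  vectors of T \<times> S with both coordinates nonzero.\<close>

lemma geometric_sum_difference:
  fixes x :: int
  assumes "1 \<le> s" "1 \<le> t"
  shows "(x - 1) * ((\<Sum>i\<in>{t..s+t-1}. x ^ i) - (\<Sum>i\<in>{1..s-1}. x ^ i) - 1)
         = x ^ (s + t) - x ^ t - x ^ s + 1"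
proof -
  have "(\<Sum>i\<in>{1..s-1}. x ^ i) + 1 = (\<Sum>i<s. x ^ i)"
  proof -
    have "{..<s} = insert 0 {1..s-1}" using assms by auto
    then show ?thesis by simp
  qed
  moreover have "(\<Sum>i\<in>{t..s+t-1}. x ^ i) = x ^ t * (\<Sum>i<s. x ^ i)"
  proof -
    have "{t..s+t-1} = {0+t..<s+t}" using assms by auto
    then have "(\<Sum>i\<in>{t..s+t-1}. x ^ i) = (\<Sum>i\<in>{0..<s}. x ^ (i + t))"
      by (simp only: sum.shift_bounds_nat_ivl)
    then show ?thesis
      by (simp add: sum_distrib_left power_add mult.commute lessThan_atLeast0)
  qed
  moreover have "(x - 1) * (\<Sum>i<s. x ^ i) = x ^ s - 1"
    using power_diff_1_eq[of x s] by simp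
  ultimately have "(x - 1) * ((\<Sum>i\<in>{t..s+t-1}. x ^ i) - (\<Sum>i\<in>{1..s-1}. x ^ i) - 1)
      = x ^ t * ((x - 1) * (\<Sum>i<s. x ^ i)) - (x - 1) * (\<Sum>i<s. x ^ i)"
    by (simp add: algebra_simps)
  also have "\<dots> = x ^ (s + t) - x ^ t - x ^ s + 1"
    unfolding \<open>(x - 1) * (\<Sum>i<s. x ^ i) = x ^ s - 1\<close> by (simp add: algebra_simps power_add)
  finally show ?thesis .
qed

section \<open>Weights of points as dimensions of intersections\<close>

locale finite_field_embedding = field_embedding emb
  for emb :: "'q::{field,finite} \<Rightarrow> 'a::{field,finite}"
begin

lemma fq_subspaceD:
  assumes "fq_subspace emb W"
  shows "0 \<in> W" "x \<in> W \<Longrightarrow> y \<in> W \<Longrightarrow> x + y \<in> W" "x \<in> W \<Longrightarrow> emb c * x \<in> W"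
  using assms by (auto simp: Fq.vs1.subspace_def fq_scale_def)

lemma card_fq_subspace: "fq_subspace emb W \<Longrightarrow> card W = CARD('q) ^ fq_dim emb W"
  by (rule Fq.vs1.card_subspace_eq_power_dim) simp_all

lemma fq_subspace_Int_image_mult:
  assumes "fq_subspace emb S" "fq_subspace emb T"
  shows "fq_subspace emb (S \<inter> (\<lambda>x. a * x) ` T)"
proof -
  have "a * x + a * y = a * (x + y)" "emb c * (a * x) = a * (emb c * x)" for x y c
    by (simp_all add: algebra_simps)
  then show ?thesis
    using fq_subspaceD[OF assms(1)] fq_subspaceD[OF assms(2)]
    unfolding Fq.vs1.subspace_def fq_scale_def by (auto simp: image_iff)
qed

text \<open>A point, being closed under all scalars of the large field, is also a subspace over the
  small one, so its intersection with T \<times> S is a subspace whose dimension is the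
  weight.\<close>

lemma card_Times_Int_point:
  assumes S: "fq_subspace emb S" and T: "fq_subspace emb T"
  shows "card (T \<times> S \<inter> point v) = CARD('q) ^ weight emb (T \<times> S) (point v)"
proof -
  have "Fq.p.subspace (T \<times> S \<inter> point v)"
  proof (rule Fq.p.subspace_inter)
    show "Fq.p.subspace (T \<times> S)" using T S by (rule Fq.subspace_Times)
    have "\<exists>c. a * fst v + b * fst v = c * fst v \<and> a * snd v + b * snd v = c * snd v" for a b
      by (auto intro: exI[of _ "a + b"] simp: algebra_simps)
    moreover have "\<exists>c. a * (b * fst v) = c * fst v \<and> a * (b * snd v) = c * snd v" for a b
      by (auto intro: exI[of _ "a * b"] simp: algebra_simps)
    ultimately show "Fq.p.subspace (point v)"
      unfolding Fq.p.subspace_def point_eq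
      by (auto simp: Fq.scale_def fq_scale_def zero_prod_def)
  qed
  then show ?thesis
    unfolding weight_def by (intro Fq.p.card_subspace_eq_power_dim) simp_all
qed

text \<open>As \<open>y\<close> is nonzero, a vector of the point is determined by its second
  coordinate b; its first is (x/y) b, which lies in \<open>T\<close> exactly when b lies in (y/x)
  T.\<close>

lemma card_Int_point_eq:
  assumes "x \<noteq> 0" "y \<noteq> 0"
  shows "card (T \<times> S \<inter> point (x, y)) = card (S \<inter> (\<lambda>z. y / x * z) ` T)"
proof (rule bij_betw_same_card[of snd], unfold bij_betw_def, intro conjI)
  show "inj_on snd (T \<times> S \<inter> point (x, y))"
    using assms by (auto simp: inj_on_def point_eq)
  show "snd ` (T \<times> S \<inter> point (x, y)) = S \<inter> (\<lambda>z. y / x * z) ` T"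
  proof (intro equalityI subsetI)
    fix b assume "b \<in> snd ` (T \<times> S \<inter> point (x, y))"
    then obtain c where "b = c * y" "c * x \<in> T" "c * y \<in> S"
      by (force simp: point_eq)
    then show "b \<in> S \<inter> (\<lambda>z. y / x * z) ` T"
      using assms by (auto intro!: image_eqI[of _ _ "c * x"])
  next
    fix b assume "b \<in> S \<inter> (\<lambda>z. y / x * z) ` T"
    then obtain z where "b \<in> S" "z \<in> T" "b = y / x * z" by auto
    then show "b \<in> snd ` (T \<times> S \<inter> point (x, y))"
      using assms by (auto simp: point_eq intro!: image_eqI[of _ _ "(z, b)"] exI[of _ "z / x"])
  qed
qed

text \<open>Both sides are exponents of the same cardinality to a base above 1, so no linear
  isomorphism has to be constructed.\<close>

lemma weight_eq_dim:
  assumes "fq_subspace emb S" "fq_subspace emb T" "x \<noteq> 0" "y \<noteq> 0"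
  shows "weight emb (T \<times> S) (point (x, y)) = fq_dim emb (S \<inter> (\<lambda>z. y / x * z) ` T)"
proof -
  have "CARD('q) > 1" by (rule one_less_card_field)
  moreover have "CARD('q) ^ weight emb (T \<times> S) (point (x, y))
      = CARD('q) ^ fq_dim emb (S \<inter> (\<lambda>z. y / x * z) ` T)"
    using card_Int_point_eq[OF assms(3,4), of T S] card_Times_Int_point[OF assms(1,2), of "(x, y)"]
      card_fq_subspace[OF fq_subspace_Int_image_mult[OF assms(1,2), of "y / x"]] by simp
  ultimately show ?thesis by simp
qed

end

theorem theorem4p1:
  fixes emb :: "'q::{field,finite} \<Rightarrow> 'a::{field,finite}"
    and S T :: "'a set"
    and U :: "('a \<times> 'a) set"
    and q n k s t :: nat
  assumes "field_embedding emb"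
    and "CARD('q) = q" and "CARD('a) = q ^ n"
    and "fq_subspace emb S" and "fq_subspace emb T"
    and "fq_dim emb S = s" and "fq_dim emb T = t"
    and "s + t = k" and "k \<le> n"
    and "1 \<le> s" and "s \<le> t"
    and "U = T \<times> S"
  defines "cond_i \<equiv> int (card (linear_set U)) =
             (\<Sum>i\<in>{t..k-1}. int q ^ i) - (\<Sum>i\<in>{1..s-1}. int q ^ i) + 1"
    and "cond_ii \<equiv> \<forall>P \<in> linear_set U. P \<noteq> point (1, 0) \<and> P \<noteq> point (0, 1) \<longrightarrow> weight emb U P = 1"
    and "cond_iii \<equiv> (S * inv_set S) \<inter> (T * inv_set T) = range emb"
    and "cond_iv \<equiv> \<forall>\<alpha>. \<alpha> \<noteq> 0 \<longrightarrow> fq_dim emb (S \<inter> (\<lambda>x. \<alpha> * x) ` T) \<le> 1"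
  shows "(cond_i \<longleftrightarrow> cond_ii) \<and> (cond_ii \<longleftrightarrow> cond_iii) \<and> (cond_iii \<longleftrightarrow> cond_iv)"
proof -
  interpret finite_field_embedding emb
    using assms(1) by (simp add: finite_field_embedding_def)
  note S = \<open>fq_subspace emb S\<close> and T = \<open>fq_subspace emb T\<close>
  have q: "q > 1" using assms(2) one_less_card_field[where 'a = 'q] by simp
  have cS: "card S = q ^ s" and cT: "card T = q ^ t"
    using card_fq_subspace S T assms by auto
  \<comment> \<open>Positive dimension gives at least q > 1 elements. The nonzero \<open>s0\<close>
    and \<open>t0\<close> obtained from this put both coordinate points into L_U.\<close>
  have nonzero: "\<exists>x\<in>W. x \<noteq> 0" if "card W = q ^ r" "1 \<le> r" for W :: "'a set" and r
  proof (rule ccontr)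
    assume "\<not> ?thesis"
    then have "card W \<le> 1" using card_mono[of "{0}" W] by auto
    moreover have "q ^ 1 \<le> q ^ r" using that(2) q by (intro power_increasing) auto
    ultimately show False using that(1) q by simp
  qed
  obtain s0 where s0: "s0 \<in> S" "s0 \<noteq> 0" using nonzero[OF cS] assms by auto
  obtain t0 where t0: "t0 \<in> T" "t0 \<noteq> 0" using nonzero[OF cT] assms by auto
  have z: "0 \<in> S" "0 \<in> T" using fq_subspaceD S T by auto

  \<comment> \<open>Points of L_U off the coordinate axes\<close>
  define L where "L = linear_set U - {point (1, 0), point (0, 1)}"
  have pT: "point (x, 0) = point (1, 0)" if "x \<noteq> 0" for x :: 'a
    using that by (intro point_eq_of_mem) (auto simp: point_eq zero_prod_def)
  have pS: "point (0, x) = point (0, 1)" if "x \<noteq> 0" for x :: 'a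
    using that by (intro point_eq_of_mem) (auto simp: point_eq zero_prod_def)
  have "point (t0, 0) \<in> linear_set U" "point (0, s0) \<in> linear_set U"
    using s0 t0 z assms(12) by (fastforce simp: linear_set_def zero_prod_def)+
  then have mem: "point (1, 0) \<in> linear_set U" "point (0, 1) \<in> linear_set U"
    using pT[of t0] pS[of s0] s0 t0 by simp_all
  have "(1, 0) \<notin> point (0, 1::'a)" by (auto simp: point_eq)
  then have ne: "point (1, 0) \<noteq> point (0, 1::'a)" using in_point[of "(1, 0::'a)"] by auto
  \<comment> \<open>A nonzero vector with a zero coordinate spans one of the two axis points, so the
    remaining points are spanned by vectors with both coordinates nonzero.\<close>
  have L_iff: "P \<in> L \<longleftrightarrow> (\<exists>x\<in>T. \<exists>y\<in>S. x \<noteq> 0 \<and> y \<noteq> 0 \<and> P = point (x, y))" for P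
  proof
    assume "P \<in> L"
    then obtain x y where xy: "x \<in> T" "y \<in> S" "(x, y) \<noteq> 0" "P = point (x, y)"
        "P \<noteq> point (1, 0)" "P \<noteq> point (0, 1)"
      by (auto simp: L_def linear_set_def assms(12))
    then have "x \<noteq> 0" "y \<noteq> 0" using pT[of x] pS[of y] by (auto simp: zero_prod_def)
    then show "\<exists>x\<in>T. \<exists>y\<in>S. x \<noteq> 0 \<and> y \<noteq> 0 \<and> P = point (x, y)" using xy by blast
  next
    assume "\<exists>x\<in>T. \<exists>y\<in>S. x \<noteq> 0 \<and> y \<noteq> 0 \<and> P = point (x, y)"
    then obtain x y where xy: "x \<in> T" "y \<in> S" "x \<noteq> 0" "y \<noteq> 0" "P = point (x, y)" by blast
    have "(x, y) \<notin> point (1, 0)" "(x, y) \<notin> point (0, 1)" using xy by (auto simp: point_eq)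
    then have "P \<noteq> point (1, 0)" "P \<noteq> point (0, 1)" using in_point[of "(x, y)"] xy by auto
    then show "P \<in> L" using xy by (auto simp: L_def linear_set_def assms(12) zero_prod_def)
  qed
  have cP: "card (U \<inter> P) = q ^ weight emb U P" if "P \<in> linear_set U" for P
    using that card_Times_Int_point[OF S T] assms(2,12) by (auto simp: linear_set_def)
  \<comment> \<open>Weight 0 would leave a single vector in \<open>U \<inter> P\<close>, which
    however contains both zero and \<open>(x, y)\<close>.\<close>
  have pos: "weight emb U P \<ge> 1" if P: "P \<in> L" for P
  proof (rule ccontr)
    assume "\<not> ?thesis"
    then have c: "card (U \<inter> P) = 1" using cP[of P] P by (simp add: L_def)
    obtain x y where xy: "x \<in> T" "y \<in> S" "x \<noteq> 0" "P = point (x, y)"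
      using iffD1[OF L_iff P] by blast
    then have "{(0, 0), (x, y)} \<subseteq> U \<inter> P"
      using z in_point[of "(x, y)"] by (auto simp: assms(12) point_eq)
    then have "card {(0, 0), (x, y)} \<le> card (U \<inter> P)" by (intro card_mono) auto
    then show False using c xy(3) by simp
  qed
  have ii_L: "cond_ii \<longleftrightarrow> (\<forall>P\<in>L. weight emb U P = 1)"
    by (auto simp: cond_ii_def L_def)

  \<comment> \<open>Size of L_U against weights: (i) and (ii)\<close>
  have "cond_i \<longleftrightarrow> cond_ii"
  proof -
    have "U \<inter> point (1, 0) = T \<times> {0}" "U \<inter> point (0, 1) = {0} \<times> S"
      using z by (auto simp: assms(12) point_eq)
    then have axes: "card (U \<inter> point (1, 0)) = q ^ t" "card (U \<inter> point (0, 1)) = q ^ s"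
      by (simp_all add: card_cartesian_product cS cT)
    have cU: "card U = q ^ k"
      using cS cT by (simp add: assms(12) card_cartesian_product power_add flip: assms(8))
    have LU: "linear_set U = insert (point (1, 0)) (insert (point (0, 1)) L)"
      using mem by (auto simp: L_def)
    have notin: "point (1, 0) \<notin> L" "point (0, 1) \<notin> L" by (auto simp: L_def)
    have "0 \<in> U" using z by (simp add: assms(12) zero_prod_def)
    then have "int q ^ k - 1
        = (int q ^ t - 1) + (int q ^ s - 1) + (\<Sum>P\<in>L. int (card (U \<inter> P)) - 1)"
      using card_linear_set_partition[of U] ne notin axes cU by (simp add: LU)
    \<comment> \<open>Each term q^w - 1 splits into q - 1, the share of a point of weight one, and
      the excess q^w - q.\<close>
    also have "(\<Sum>P\<in>L. int (card (U \<inter> P)) - 1)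
        = (\<Sum>P\<in>L. int q ^ weight emb U P - int q) + (int q - 1) * int (card L)"
      using cP by (simp add: L_def sum_subtractf algebra_simps)
    finally have total: "int q ^ k - int q ^ t - int q ^ s + 1
        = (\<Sum>P\<in>L. int q ^ weight emb U P - int q) + (int q - 1) * int (card L)"
      by simp
    have "card (linear_set U) = card L + 2" using ne notin by (simp add: LU)
    \<comment> \<open>The constant changes from +1 to -1 because the two axis points are
      removed.\<close>
    then have "cond_i \<longleftrightarrow> int (card L)
        = (\<Sum>i\<in>{t..k-1}. int q ^ i) - (\<Sum>i\<in>{1..s-1}. int q ^ i) - 1"
      by (auto simp: cond_i_def)
    also have "\<dots> \<longleftrightarrow> (int q - 1) * int (card L) = (int q - 1)
        * ((\<Sum>i\<in>{t..k-1}. int q ^ i) - (\<Sum>i\<in>{1..s-1}. int q ^ i) - 1)"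
      using q by simp
    \<comment> \<open>By \<open>geometric_sum_difference\<close> the right-hand side is the
      left-hand side of \<open>total\<close>, so equality means that the total excess
      vanishes.\<close>
    also have "\<dots> \<longleftrightarrow> (\<Sum>P\<in>L. int q ^ weight emb U P - int q) = 0"
      using geometric_sum_difference[of s t "int q"] total assms(8,10,11) by auto
    \<comment> \<open>Every excess is nonnegative because weights on \<open>L\<close> are at least
      1.\<close>
    also have "\<dots> \<longleftrightarrow> (\<forall>P\<in>L. int q ^ weight emb U P - int q = 0)"
    proof (rule sum_nonneg_eq_0_iff)
      fix P assume "P \<in> L"
      then show "0 \<le> int q ^ weight emb U P - int q"
        using power_increasing[OF pos, of P "int q"] q by simp
    qed simp
    also have "\<dots> \<longleftrightarrow> (\<forall>P\<in>L. weight emb U P = 1)"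
      using q power_inject_exp[of "int q" _ 1] by simp
    finally show ?thesis by (simp add: ii_L)
  qed

  \<comment> \<open>Weights against intersections: (ii) and (iv)\<close>
  moreover have "cond_ii \<longleftrightarrow> cond_iv"
  proof
    assume ii: "cond_ii"
    show cond_iv unfolding cond_iv_def
    proof (intro allI impI)
      fix \<alpha> :: 'a assume \<alpha>: "\<alpha> \<noteq> 0"
      let ?W = "S \<inter> (\<lambda>x. \<alpha> * x) ` T"
      show "fq_dim emb ?W \<le> 1"
      \<comment> \<open>A nonzero element \<alpha>x of the intersection gives a point of
        \<open>L\<close> of slope \<alpha>, whose weight is the dimension in question. Without such
        an element the intersection is at most {0}.\<close>
      proof (cases "\<exists>x\<in>T. x \<noteq> 0 \<and> \<alpha> * x \<in> S")
        case True
        then obtain x where x: "x \<in> T" "x \<noteq> 0" "\<alpha> * x \<in> S" by blast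
        then have "point (x, \<alpha> * x) \<in> L"
          using \<alpha> by (intro iffD2[OF L_iff] bexI conjI refl) auto
        then have "weight emb U (point (x, \<alpha> * x)) = 1" using ii ii_L by simp
        then show ?thesis
          using weight_eq_dim[OF S T, of x "\<alpha> * x"] x \<alpha> by (simp add: assms(12))
      next
        case False
        then have "?W \<subseteq> {0}" by auto
        then show ?thesis
          by (subst Fq.vs1.dim_le_1_iff) (auto intro: fq_subspace_Int_image_mult S T)
      qed
    qed
  next
    assume iv: "cond_iv"
    have "weight emb U P = 1" if P: "P \<in> L" for P
    proof -
      obtain x y where xy: "x \<noteq> 0" "y \<noteq> 0" "P = point (x, y)"
        using iffD1[OF L_iff P] by blast
      then have "fq_dim emb (S \<inter> (\<lambda>z. y / x * z) ` T) \<le> 1"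
        using iv[unfolded cond_iv_def, rule_format, of "y / x"] by (meson divide_eq_0_iff)
      then have "weight emb U P \<le> 1"
        by (simp only: weight_eq_dim[OF S T xy(1,2)] assms(12) xy(3))
      then show ?thesis using pos[OF P] by simp
    qed
    then show cond_ii by (simp add: ii_L)
  qed

  \<comment> \<open>Quotient sets against intersections: (iii) and (iv)\<close>
  moreover have "cond_iii \<longleftrightarrow> cond_iv"
  proof -
    \<comment> \<open>Membership in the quotient set means that multiplication by z keeps some
      nonzero element of \<open>W\<close> inside \<open>W\<close>.\<close>
    have mem_quot: "z \<in> W * inv_set W \<longleftrightarrow> (\<exists>y\<in>W. y \<noteq> 0 \<and> z * y \<in> W)" for z and W :: "'a set"
    proof
      assume "z \<in> W * inv_set W"
      then obtain x y where "x \<in> W" "y \<in> W" "y \<noteq> 0" "z = x * inverse y"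
        by (auto simp: set_times_def inv_set_def)
      then show "\<exists>y\<in>W. y \<noteq> 0 \<and> z * y \<in> W" by (auto simp: mult.assoc)
    next
      assume "\<exists>y\<in>W. y \<noteq> 0 \<and> z * y \<in> W"
      then obtain y where y: "y \<in> W" "y \<noteq> 0" "z * y \<in> W" by blast
      then have "(z * y) * inverse y \<in> W * inv_set W"
        by (intro set_times_intro) (auto simp: inv_set_def)
      then show "z \<in> W * inv_set W" using y by (simp add: mult.assoc)
    qed
    \<comment> \<open>Scalars of the small field map \<open>s0\<close> into \<open>S\<close> and
      \<open>t0\<close> into \<open>T\<close>, so only the opposite inclusion in (iii) is at
      stake.\<close>
    have sub: "range emb \<subseteq> (S * inv_set S) \<inter> (T * inv_set T)"
      using s0 t0 fq_subspaceD(3)[OF S] fq_subspaceD(3)[OF T] by (auto simp: mem_quot)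
    have iv_iff: "cond_iv \<longleftrightarrow> (\<forall>\<alpha>. \<alpha> \<noteq> 0 \<longrightarrow> (\<forall>x\<in>S \<inter> (\<lambda>x. \<alpha> * x) ` T.
        \<forall>y\<in>S \<inter> (\<lambda>x. \<alpha> * x) ` T. y \<noteq> 0 \<longrightarrow> (\<exists>c. x = emb c * y)))"
      unfolding cond_iv_def
      using Fq.vs1.dim_le_1_iff[OF _ _ fq_subspace_Int_image_mult[OF S T]]
      by (simp add: fq_scale_def)
    show ?thesis
    proof
      assume iii: "cond_iii"
      show cond_iv unfolding iv_iff
      proof (intro allI impI ballI)
        fix \<alpha> x y :: 'a
        assume \<alpha>: "\<alpha> \<noteq> 0" and x: "x \<in> S \<inter> (\<lambda>x. \<alpha> * x) ` T"
          and y: "y \<in> S \<inter> (\<lambda>x. \<alpha> * x) ` T" "y \<noteq> 0"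
        obtain a b where ab: "x = \<alpha> * a" "y = \<alpha> * b" "a \<in> T" "b \<in> T" using x y by auto
        have b: "b \<noteq> 0" using y ab by auto
        \<comment> \<open>The factor \<alpha> cancels, so x/y = a/b is a quotient of elements of
          \<open>S\<close> and also of elements of \<open>T\<close>.\<close>
        have "x / y \<in> S * inv_set S"
          unfolding mem_quot using x y by (intro bexI[of _ y]) auto
        moreover have "x / y \<in> T * inv_set T"
          unfolding mem_quot using ab b \<alpha> by (intro bexI[of _ b]) auto
        ultimately obtain c where "x / y = emb c" using iii unfolding cond_iii_def by blast
        then show "\<exists>c. x = emb c * y" using y by (auto simp: field_simps)
      qed
    next
      assume iv: "cond_iv"
      have "z \<in> range emb" if zS: "z \<in> S * inv_set S" and zT: "z \<in> T * inv_set T" for z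
      proof -
        obtain y b where y: "y \<in> S" "y \<noteq> 0" "z * y \<in> S" and b: "b \<in> T" "b \<noteq> 0" "z * b \<in> T"
          using zS zT unfolding mem_quot by blast
        \<comment> \<open>The choice \<alpha> = y/b gives y = \<alpha>b and zy = \<alpha>(zb), so
          both \<open>y\<close> and \<open>z * y\<close> lie in the intersection of S and \<alpha>T.
          By (iv) they are proportional over the small field, and cancelling \<open>y\<close>
          identifies z.\<close>
        have \<alpha>: "y / b \<noteq> 0" using y b by simp
        have "y \<in> S \<inter> (\<lambda>x. y / b * x) ` T"
          using y b by (auto intro!: image_eqI[of _ _ b])
        moreover have "z * y \<in> S \<inter> (\<lambda>x. y / b * x) ` T"
          using y b by (auto intro!: image_eqI[of _ _ "z * b"])
        ultimately obtain c where "z * y = emb c * y" using iv \<alpha> y(2) unfolding iv_iff by blast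
        then show ?thesis using y by simp
      qed
      then show cond_iii using sub unfolding cond_iii_def by blast
    qed
  qed
  ultimately show ?thesis by blast
qed

end
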